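(* Let $\mathbb{F}$ be an arbitrary field and let $\mathcal{T}\in\mathbb{F}^{d_1\times\cdots\times d_n}$ have multilinear rank $(r_1,\dots,r_n)$. For each $i\in\{1,\dots,n\}$ let $I_i\subset\{1,\dots,d_i\}$ and $J_i\subset\{1,\dots,\prod_{j\neq i}d_j\}$. Set $\mathcal{R}=\mathcal{T}(I_1,\dots,I_n)$, $C_i=\mathcal{T}_{(i)}(:,J_i)$ and $U_i=C_i(I_i,:)$. Then the following statements are equivalent: (i) $\operatorname{rank}(U_i)=r_i$ for all $i=1,\dots,n$; (ii) $\mathcal{T}=\mathcal{R}\times_1(C_1U_1^\sim)\times_2\cdots\times_n(C_nU_n^\sim)$ for some generalized inverses $U_1^\sim,\dots,U_n^\sim$ of $U_1,\dots,U_n$; (iii) $\mathcal{T}=\mathcal{R}\times_1(C_1U_1^\sim)\times_2\cdots\times_n(C_nU_n^\sim)$ for all generalized inverses $U_1^\sim,\dots,U_n^\sim$ of $U_1,\dots,U_n$; (iv) $\operatorname{rank}(C_i)=r_i$ for all $i=1,\dots,n$ and the multilinear rank of $\mathcal{R}$ is $(r_1,\dots,r_n)$. Moreover, if any of the equivalent statements above hold, then $\mathcal{T}=\mathcal{T}\times_1(C_1C_1^\sim)\times_2\cdots\times_n(C_nC_n^\sim)$ for all generalized inverses $C_1^\sim,\dots,C_n^\sim$ of $C_1,\dots,C_n$.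
   Context: A generalized inverse of a matrix $M\in\mathbb{F}^{p\times q}$ is any $M^\sim\in\mathbb{F}^{q\times p}$ with $MM^\sim M=M$. $M(I,:)$ and $M(:,J)$ denote the submatrices of rows indexed by $I$ and of columns indexed by $J$. For a tensor $\mathcal{T}\in\mathbb{F}^{d_1\times\cdots\times d_n}$, its mode-$i$ unfolding is the matrix $\mathcal{T}_{(i)}\in\mathbb{F}^{d_i\times\prod_{j\neq i}d_j}$ whose row index is the $i$-th tensor index and whose columns are indexed by the remaining indices, via a fixed bijection between $\prod_{j\ne i}\{1,\dots,d_j\}$ and $\{1,\dots,\prod_{j\neq i}d_j\}$. For $Y\in\mathbb{F}^{m\times d_i}$, the mode-$i$ product $\mathcal{T}\times_iY$ is the tensor of size $d_1\times\cdots\times d_{i-1}\times m\times d_{i+1}\times\cdots\times d_n$ determined by $(\mathcal{T}\times_iY)_{(i)}=Y\mathcal{T}_{(i)}$. $\mathcal{T}$ has multilinear rank $(r_1,\dots,r_n)$ if $\operatorname{rank}(\mathcal{T}_{(i)})=r_i$ for all $i$. $\mathcal{T}(I_1,\dots,I_n)$ is the subtensor of entries whose $j$-th index lies in $I_j$ for every $j$. *)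

theory Defs
  imports
    "Jordan_Normal_Form.DL_Rank"
    "Jordan_Normal_Form.DL_Submatrix"
    "HOL-Library.FuncSet"
begin

section \<open>Tensors\<close>

text \<open>Indices and modes are counted from 0, as in the matrix library: the modes of a tensor with
  dimension list \<open>ds\<close> are \<open>0, \<dots>, length ds - 1\<close> and the \<open>i\<close>-th index runs over
  \<open>{0..<ds ! i}\<close>. Entries are fixed outside this range, so that equality of tensors is equality
  of the dimensions and of all entries.\<close>

definition multi_indices :: "nat list \<Rightarrow> nat list set" where
  "multi_indices ds = {is. length is = length ds \<and> (\<forall>j<length ds. is ! j < ds ! j)}"

typedef 'a tensor = "{(ds, f :: nat list \<Rightarrow> 'a). f \<in> extensional (multi_indices ds)}"
  by (rule exI[of _ "([], \<lambda>_. undefined)"]) (simp add: extensional_def)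

definition mk_tensor :: "nat list \<Rightarrow> (nat list \<Rightarrow> 'a) \<Rightarrow> 'a tensor" where
  "mk_tensor ds f = Abs_tensor (ds, restrict f (multi_indices ds))"

definition dims :: "'a tensor \<Rightarrow> nat list" where
  "dims T = fst (Rep_tensor T)"

definition entry :: "'a tensor \<Rightarrow> nat list \<Rightarrow> 'a" where
  "entry T = snd (Rep_tensor T)"

definition order_tensor :: "'a tensor \<Rightarrow> nat" where
  "order_tensor T = length (dims T)"

lemma dims_mk_tensor [simp]: "dims (mk_tensor ds f) = ds"
  by (simp add: dims_def mk_tensor_def Abs_tensor_inverse)

lemma entry_mk_tensor [simp]: "is \<in> multi_indices ds \<Longrightarrow> entry (mk_tensor ds f) is = f is"
  by (simp add: entry_def mk_tensor_def Abs_tensor_inverse)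

lemma tensor_eqI:
  assumes "dims S = dims T" and "\<And>is. is \<in> multi_indices (dims T) \<Longrightarrow> entry S is = entry T is"
  shows "S = T"
proof -
  have "snd (Rep_tensor X) \<in> extensional (multi_indices (fst (Rep_tensor X)))" for X :: "'a tensor"
    using Rep_tensor[of X] by (auto simp: case_prod_beta)
  then have "snd (Rep_tensor S) = snd (Rep_tensor T)"
    using assms unfolding dims_def entry_def by (metis extensionalityI)
  with assms(1) show ?thesis
    by (simp add: dims_def prod_eq_iff flip: Rep_tensor_inject)
qed

text \<open>The subtensor of the entries whose \<open>j\<close>-th index lies in \<open>I j\<close>, for every mode \<open>j\<close>.
  As for \<^const>\<open>submatrix\<close>, the elements of \<open>I j\<close> are renumbered increasingly.\<close>

definition subtensor :: "'a tensor \<Rightarrow> (nat \<Rightarrow> nat set) \<Rightarrow> 'a tensor" where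
  "subtensor T I =
     mk_tensor (map (\<lambda>j. card {k. k < dims T ! j \<and> k \<in> I j}) [0..<order_tensor T])
       (\<lambda>ks. entry T (map (\<lambda>j. pick (I j) (ks ! j)) [0..<order_tensor T]))"


section \<open>Unfoldings\<close>

definition remove_nth :: "nat \<Rightarrow> 'b list \<Rightarrow> 'b list" where
  "remove_nth i xs = take i xs @ drop (Suc i) xs"

definition insert_nth :: "nat \<Rightarrow> 'b \<Rightarrow> 'b list \<Rightarrow> 'b list" where
  "insert_nth i x xs = take i xs @ x # drop i xs"

text \<open>The bijections used to number the columns of the unfoldings: if \<open>es\<close> is the list of the
  dimensions of a tensor other than the \<open>i\<close>-th one, then column \<open>c\<close> of its mode-\<open>i\<close> unfolding
  belongs to the remaining indices \<open>\<phi> i es c\<close>. The bijection does not involve the \<open>i\<close>-th dimension,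
  so it is the same for a tensor and for its mode-\<open>i\<close> products.\<close>

definition column_numbering :: "(nat \<Rightarrow> nat list \<Rightarrow> nat \<Rightarrow> nat list) \<Rightarrow> bool" where
  "column_numbering \<phi> \<longleftrightarrow>
     (\<forall>i es. bij_betw (\<phi> i es) {0..<prod_list es} (multi_indices es))"

definition unfolding_mat ::
  "(nat \<Rightarrow> nat list \<Rightarrow> nat \<Rightarrow> nat list) \<Rightarrow> nat \<Rightarrow> 'a tensor \<Rightarrow> 'a mat" where
  "unfolding_mat \<phi> i T =
     mat (dims T ! i) (prod_list (remove_nth i (dims T)))
       (\<lambda>(k, c). entry T (insert_nth i k (\<phi> i (remove_nth i (dims T)) c)))"

definition mode_product ::
  "(nat \<Rightarrow> nat list \<Rightarrow> nat \<Rightarrow> nat list) \<Rightarrow> nat \<Rightarrow> 'a::semiring_0 tensor \<Rightarrow> 'a mat \<Rightarrow> 'a tensor" where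
  "mode_product \<phi> i T Y =
     (THE S. dims S = (dims T)[i := dim_row Y] \<and>
             unfolding_mat \<phi> i S = Y * unfolding_mat \<phi> i T)"

text \<open>\<open>T \<times>\<^sub>1 Y\<^sub>1 \<times>\<^sub>2 \<dots> \<times>\<^sub>n Y\<^sub>n\<close>, evaluated from left to right.\<close>

definition mode_products ::
  "(nat \<Rightarrow> nat list \<Rightarrow> nat \<Rightarrow> nat list) \<Rightarrow> 'a::semiring_0 tensor \<Rightarrow> (nat \<Rightarrow> 'a mat) \<Rightarrow> 'a tensor" where
  "mode_products \<phi> T Y = fold (\<lambda>i S. mode_product \<phi> i S (Y i)) [0..<order_tensor T] T"


section \<open>Ranks and generalized inverses\<close>

definition mat_rank :: "'a::field mat \<Rightarrow> nat" where
  "mat_rank A = vec_space.rank (dim_row A) A"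

definition has_multilinear_rank ::
  "(nat \<Rightarrow> nat list \<Rightarrow> nat \<Rightarrow> nat list) \<Rightarrow> 'a::field tensor \<Rightarrow> nat list \<Rightarrow> bool" where
  "has_multilinear_rank \<phi> T r \<longleftrightarrow>
     length r = order_tensor T \<and> (\<forall>i<order_tensor T. mat_rank (unfolding_mat \<phi> i T) = r ! i)"

definition generalized_inverse :: "'a::semiring_0 mat \<Rightarrow> 'a mat \<Rightarrow> bool" where
  "generalized_inverse M X \<longleftrightarrow>
     X \<in> carrier_mat (dim_col M) (dim_row M) \<and> M * X * M = M"


section \<open>Well-definedness of the mode products\<close>

lemma remove_insert_nth [simp]: "i \<le> length xs \<Longrightarrow> remove_nth i (insert_nth i x xs) = xs"
  by (simp add: remove_nth_def insert_nth_def)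

lemma insert_remove_nth: "i < length xs \<Longrightarrow> insert_nth i (xs ! i) (remove_nth i xs) = xs"
  by (simp add: remove_nth_def insert_nth_def id_take_nth_drop[symmetric] min_def)

lemma remove_nth_update [simp]: "remove_nth i (xs[i := x]) = remove_nth i xs"
  by (simp add: remove_nth_def)

lemma insert_nth_same: "i \<le> length xs \<Longrightarrow> insert_nth i x xs ! i = x"
  by (simp add: insert_nth_def nth_append)

lemma multi_indices_list_all2: "multi_indices ds = {is. list_all2 (<) is ds}"
  by (auto simp: multi_indices_def list_all2_conv_all_nth)

lemma remove_nth_multi_indices:
  "is \<in> multi_indices ds \<Longrightarrow> remove_nth i is \<in> multi_indices (remove_nth i ds)"
  unfolding multi_indices_list_all2 remove_nth_def
  by (simp add: list_all2_appendI list_all2_takeI list_all2_dropI)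

lemma insert_nth_multi_indices:
  assumes "i < length ds" "k < ds ! i" "js \<in> multi_indices (remove_nth i ds)"
  shows "insert_nth i k js \<in> multi_indices ds"
proof -
  have "list_all2 (<) (insert_nth i k js) (insert_nth i (ds ! i) (remove_nth i ds))"
    using assms unfolding multi_indices_list_all2 insert_nth_def
    by (auto intro!: list_all2_appendI list_all2_takeI list_all2_dropI)
  then show ?thesis
    using assms(1) by (simp add: multi_indices_list_all2 insert_remove_nth)
qed

lemma unfolding_mat_inject:
  assumes \<phi>: "column_numbering \<phi>" and i: "i < order_tensor T"
    and d: "dims S = dims T" and u: "unfolding_mat \<phi> i S = unfolding_mat \<phi> i T"
  shows "S = T"
proof (rule tensor_eqI[OF d])
  fix "is" assume m: "is \<in> multi_indices (dims T)"
  let ?es = "remove_nth i (dims T)"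
  have bij: "bij_betw (\<phi> i ?es) {0..<prod_list ?es} (multi_indices ?es)"
    using \<phi> by (simp add: column_numbering_def)
  obtain c where c: "c < prod_list ?es" "\<phi> i ?es c = remove_nth i is"
    using bij_betw_imp_surj_on[OF bij] remove_nth_multi_indices[OF m, of i] by force
  have k: "is ! i < dims T ! i" "i < length is"
    using m i by (auto simp: multi_indices_def order_tensor_def)
  have "unfolding_mat \<phi> i S $$ (is ! i, c) = unfolding_mat \<phi> i T $$ (is ! i, c)"
    by (simp add: u)
  then show "entry S is = entry T is"
    using c k by (simp add: unfolding_mat_def d insert_remove_nth)
qed

lemma ex_unfolding_mat:
  assumes \<phi>: "column_numbering \<phi>" and i: "i < length ds"
    and M: "M \<in> carrier_mat (ds ! i) (prod_list (remove_nth i ds))"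
  shows "\<exists>S. dims S = ds \<and> unfolding_mat \<phi> i S = M"
proof -
  let ?es = "remove_nth i ds" and ?N = "{0..<prod_list (remove_nth i ds)}"
  have bij: "bij_betw (\<phi> i ?es) ?N (multi_indices ?es)"
    using \<phi> by (simp add: column_numbering_def)
  let ?S = "mk_tensor ds (\<lambda>is. M $$ (is ! i, inv_into ?N (\<phi> i ?es) (remove_nth i is)))"
  have "unfolding_mat \<phi> i ?S = M"
  proof (rule eq_matI)
    fix k c assume "k < dim_row M" "c < dim_col M"
    then have kc: "k < ds ! i" "c < prod_list ?es" using M by auto
    have js: "\<phi> i ?es c \<in> multi_indices ?es"
      using bij_betwE[OF bij] kc by simp
    then have "i \<le> length (\<phi> i ?es c)"
      using i by (simp add: multi_indices_def remove_nth_def)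
    then show "unfolding_mat \<phi> i ?S $$ (k, c) = M $$ (k, c)"
      using kc insert_nth_multi_indices[OF i kc(1) js] bij_betw_inv_into_left[OF bij]
      by (simp add: unfolding_mat_def insert_nth_same)
  qed (use M in \<open>auto simp: unfolding_mat_def\<close>)
  then show ?thesis by (intro exI[of _ ?S]) simp
qed

lemma mode_product:
  assumes \<phi>: "column_numbering \<phi>" and i: "i < order_tensor T"
  shows "dims (mode_product \<phi> i T Y) = (dims T)[i := dim_row Y]"
    and "unfolding_mat \<phi> i (mode_product \<phi> i T Y) = Y * unfolding_mat \<phi> i T"
proof -
  let ?P = "\<lambda>S. dims S = (dims T)[i := dim_row Y] \<and> unfolding_mat \<phi> i S = Y * unfolding_mat \<phi> i T"
  have ex: "\<exists>S. ?P S"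
    using i by (intro ex_unfolding_mat[OF \<phi>]) (auto simp: order_tensor_def unfolding_mat_def)
  have uniq: "S = S'" if "?P S" "?P S'" for S S'
    using that i by (intro unfolding_mat_inject[OF \<phi>, of i]) (auto simp: order_tensor_def)
  have "\<exists>!S. ?P S"
    by (rule ex_ex1I[OF ex uniq])
  then have "?P (THE S. ?P S)"
    by (rule theI')
  then show "dims (mode_product \<phi> i T Y) = (dims T)[i := dim_row Y]"
    and "unfolding_mat \<phi> i (mode_product \<phi> i T Y) = Y * unfolding_mat \<phi> i T"
    by (simp_all add: mode_product_def)
qed

lemma multi_indices_Cons:
  "multi_indices (d # ds) = (\<lambda>(k, ks). k # ks) ` ({0..<d} \<times> multi_indices ds)"
  by (auto simp: multi_indices_list_all2 list_all2_Cons2)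

lemma card_multi_indices: "finite (multi_indices ds) \<and> card (multi_indices ds) = prod_list ds"
proof (induction ds)
  case Nil
  then show ?case by (simp add: multi_indices_def)
next
  case (Cons d ds)
  have "inj_on (\<lambda>(k, ks). k # ks) ({0..<d} \<times> multi_indices ds)"
    by (auto simp: inj_on_def)
  with Cons show ?case
    by (simp add: multi_indices_Cons card_image card_cartesian_product)
qed

lemma ex_column_numbering: "\<exists>\<phi>. column_numbering \<phi>"
proof -
  have "\<exists>h. bij_betw h {0..<prod_list es} (multi_indices es)" for es
    using card_multi_indices[of es] by (metis ex_bij_betw_nat_finite)
  then obtain h where "\<And>es. bij_betw (h es) {0..<prod_list es} (multi_indices es)"
    by metis
  then show ?thesis
    by (intro exI[of _ "\<lambda>_. h"]) (simp add: column_numbering_def)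
qed

end

theory Submission
  imports Defs
begin

text \<open>The proof runs (iii) \<open>\<Longrightarrow>\<close> (ii) \<open>\<Longrightarrow>\<close> (iv) \<open>\<Longrightarrow>\<close> (i) \<open>\<Longrightarrow>\<close> (iii). Write \<open>M\<^sub>i\<close> for the
  mode-\<open>i\<close> unfolding of \<open>T\<close>, \<open>N\<^sub>i\<close> for that of \<open>R\<close>, and \<open>P\<^sub>i\<close> for the 0-1 matrix that selects
  the rows in \<open>I\<^sub>i\<close>, so that \<open>U\<^sub>i = P\<^sub>i C\<^sub>i\<close>.

  (i) \<open>\<Longrightarrow>\<close> (iii). Since \<open>rank U\<^sub>i \<le> rank C\<^sub>i \<le> rank M\<^sub>i\<close>, all three ranks agree. Hence \<open>C\<^sub>i\<close> has the
  column space of \<open>M\<^sub>i\<close> and the row space of \<open>U\<^sub>i\<close>, which makes \<open>C\<^sub>i U\<^sub>i\<^sup>\<sim>\<close> recover \<open>M\<^sub>i\<close> from its selected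
  rows: \<open>(C\<^sub>i U\<^sub>i\<^sup>\<sim>) P\<^sub>i M\<^sub>i = M\<^sub>i\<close> (\<open>generalized_inverse_sketch\<close>). Consequently the mode-\<open>i\<close> product
  with \<open>C\<^sub>i U\<^sub>i\<^sup>\<sim>\<close> removes the restriction to \<open>I\<^sub>i\<close> from any subtensor of \<open>T\<close>, and carrying the
  products out one after the other turns \<open>R\<close> into \<open>T\<close> (\<open>mode_products_subtensor\<close>).

  (iii) \<open>\<Longrightarrow>\<close> (ii) is the existence of generalized inverses.

  (ii) \<open>\<Longrightarrow>\<close> (iv). A mode product in a mode other than \<open>i\<close> multiplies the mode-\<open>i\<close> unfolding by a matrix
  on the right, so (ii) gives \<open>M\<^sub>i = C\<^sub>i U\<^sub>i\<^sup>\<sim> N\<^sub>i K\<close> for some \<open>K\<close> (\<open>unfolding_mode_products\<close>). Thus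
  the ranks of \<open>C\<^sub>i\<close> and \<open>N\<^sub>i\<close> are at least that of \<open>M\<^sub>i\<close>. They are at most that of \<open>M\<^sub>i\<close> because
  both matrices arise from \<open>M\<^sub>i\<close> by selecting rows and columns.

  (iv) \<open>\<Longrightarrow>\<close> (i). If \<open>rank C\<^sub>i = rank M\<^sub>i\<close>, then \<open>M\<^sub>i = C\<^sub>i X\<close> for some \<open>X\<close>. As \<open>N\<^sub>i\<close> consists of columns of
  \<open>P\<^sub>i M\<^sub>i = U\<^sub>i X\<close> (\<open>unfolding_subtensor\<close>), its rank bounds \<open>rank U\<^sub>i\<close> from below.

  The final claim is the same kind of cancellation: \<open>C\<^sub>i C\<^sub>i\<^sup>\<sim> M\<^sub>i = C\<^sub>i C\<^sub>i\<^sup>\<sim> C\<^sub>i X = C\<^sub>i X = M\<^sub>i\<close>, so every single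
  mode product with \<open>C\<^sub>i C\<^sub>i\<^sup>\<sim>\<close> fixes \<open>T\<close>.\<close>


section \<open>Rank of matrix products\<close>

text \<open>The rank is the dimension of the span of the columns, so it bounds every linearly independent
  subset of this span, not only the subsets of the set of columns.\<close>

lemma (in vec_space) indpt_in_col_space_le_rank:
  assumes A: "A \<in> carrier_mat n nc" and S: "S \<subseteq> span (set (cols A))" "lin_indpt S"
  shows "finite S \<and> card S \<le> rank A"
proof -
  let ?W = "span (set (cols A))"
  have cols: "set (cols A) \<subseteq> carrier_vec n" using cols_dim[of A] A by auto
  have vs: "vectorspace class_ring (vs ?W)"
    using span_is_subspace[OF cols] by (rule subspace_is_vs)
  have "LinearCombinations.module.lin_indpt class_ring (vs ?W) S"
    using span_li_not_depend(2)[OF S(1) span_is_submodule[OF cols]] S(2) by simp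
  then show ?thesis
    using vectorspace.li_le_dim[OF vs fin_dim_span_cols[OF A]] S(1) unfolding rank_def by simp
qed

text \<open>A column outside the span of \<open>S\<close> could be added to \<open>S\<close> and would make it too large an
  independent set.\<close>

lemma (in vec_space) col_space_le_span_indpt:
  assumes A: "A \<in> carrier_mat n nc" and S: "S \<subseteq> span (set (cols A))" "lin_indpt S"
    and card: "rank A \<le> card S"
  shows "set (cols A) \<subseteq> span S"
proof (rule ccontr)
  assume "\<not> set (cols A) \<subseteq> span S"
  then obtain w where w: "w \<in> set (cols A)" "w \<notin> span S" by blast
  have cols: "set (cols A) \<subseteq> carrier_vec n" using cols_dim[of A] A by auto
  have SV: "S \<subseteq> carrier_vec n" using S(1) span_is_subset2[OF cols] by blast
  have wS: "w \<notin> S" using w SV in_own_span by blast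
  have fin: "finite S" using indpt_in_col_space_le_rank[OF A S] by simp
  have "lin_indpt (S \<union> {w})"
    using lin_dep_iff_in_span[OF SV S(2) _ wS] w cols by blast
  moreover have "S \<union> {w} \<subseteq> span (set (cols A))"
    using S(1) w in_own_span[OF cols] by blast
  ultimately have "card (S \<union> {w}) \<le> rank A"
    using indpt_in_col_space_le_rank[OF A] by blast
  then show False using card fin wS by simp
qed

lemma (in vec_space) ex_indpt_cols_card_rank:
  assumes A: "A \<in> carrier_mat n nc"
  shows "\<exists>S. S \<subseteq> set (cols A) \<and> lin_indpt S \<and> card S = rank A"
proof -
  have "\<exists>S. finite S \<and> maximal S (\<lambda>T. T \<subseteq> set (cols A) \<and> lin_indpt T) \<and> {} \<subseteq> S"
    by (rule maximal_exists_superset[of "set (cols A)"]) (auto simp: lin_dep_def)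
  then obtain S where S: "maximal S (\<lambda>T. T \<subseteq> set (cols A) \<and> lin_indpt T)" by blast
  show ?thesis using rank_card_indpt[OF A S] S unfolding maximal_def by auto
qed

lemma (in vec_space) ex_mult_if_cols_in_col_space:
  assumes A: "A \<in> carrier_mat n m" and B: "B \<in> carrier_mat n k"
    and sub: "set (cols A) \<subseteq> span (set (cols B))"
  shows "\<exists>Y \<in> carrier_mat k m. A = B * Y"
proof -
  have "\<exists>x \<in> carrier_vec k. B *\<^sub>v x = col A j" if "j < m" for j
  proof -
    have "col A j \<in> set (cols A)" using that A by (auto simp: cols_def)
    then have "col A j \<in> col_space B" using sub by (auto simp: col_space_def)
    then show ?thesis using col_space_eq[OF B] B by auto
  qed
  then obtain x where x: "\<And>j. j < m \<Longrightarrow> x j \<in> carrier_vec k \<and> B *\<^sub>v x j = col A j"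
    by metis
  let ?Y = "mat_of_cols k (map x [0..<m])"
  have "A = B * ?Y"
  proof (rule mat_col_eqI)
    fix j assume "j < dim_col (B * ?Y)"
    then have j: "j < m" by simp
    then have "col (B * ?Y) j = B *\<^sub>v col ?Y j" using B by (intro col_mult2) auto
    also have "col ?Y j = x j" using j x[OF j] by (simp add: col_mat_of_cols)
    finally show "col A j = col (B * ?Y) j" using x[OF j] by simp
  qed (use A B in auto)
  then show ?thesis by (intro bexI[of _ ?Y]) auto
qed

lemma (in vec_space) cols_mult_in_col_space:
  assumes A: "A \<in> carrier_mat n k" and Y: "Y \<in> carrier_mat k m"
  shows "set (cols (A * Y)) \<subseteq> span (set (cols A))"
proof
  fix v assume "v \<in> set (cols (A * Y))"
  then obtain j where j: "j < m" "v = col (A * Y) j" using Y by (auto simp: cols_def)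
  have "v = A *\<^sub>v col Y j" unfolding j(2) by (rule col_mult2[OF A Y j(1)])
  then have "v \<in> col_space A"
    unfolding col_space_eq[OF A] using A Y j by auto
  then show "v \<in> span (set (cols A))" by (simp add: col_space_def)
qed

lemma mat_rank_le_dim_col: "mat_rank A \<le> dim_col A"
  unfolding mat_rank_def by (rule vec_space.rank_le_nc) auto

lemma mat_rank_mult_le_left:
  assumes A: "A \<in> carrier_mat n k" and Y: "Y \<in> carrier_mat k m"
  shows "mat_rank (A * Y) \<le> mat_rank A"
proof -
  interpret vec_space "TYPE('a)" n .
  obtain S where "S \<subseteq> set (cols (A * Y))" "lin_indpt S" "card S = rank (A * Y)"
    using ex_indpt_cols_card_rank[of "A * Y" m] A Y by auto
  then show ?thesis
    using indpt_in_col_space_le_rank[OF A, of S] cols_mult_in_col_space[OF A Y] A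
    by (auto simp: mat_rank_def)
qed

text \<open>The column space of \<open>A * Y\<close> is contained in that of \<open>A\<close>, so equality of the dimensions forces
  equality of the spaces.\<close>

lemma mat_rank_mult_left_eqE:
  assumes A: "A \<in> carrier_mat n k" and Y: "Y \<in> carrier_mat k m"
    and r: "mat_rank (A * Y) = mat_rank A"
  obtains Z where "Z \<in> carrier_mat m k" "A = A * Y * Z"
proof -
  interpret vec_space "TYPE('a)" n .
  have AY: "A * Y \<in> carrier_mat n m" using A Y by simp
  obtain S where S: "S \<subseteq> set (cols (A * Y))" "lin_indpt S" "card S = rank (A * Y)"
    using ex_indpt_cols_card_rank[OF AY] by auto
  have "set (cols A) \<subseteq> span S"
    using S r A cols_mult_in_col_space[OF A Y]
    by (intro col_space_le_span_indpt[OF A]) (auto simp: mat_rank_def)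
  also have "span S \<subseteq> span (set (cols (A * Y)))"
    using S(1) by (rule span_is_monotone)
  finally show ?thesis
    using ex_mult_if_cols_in_col_space[OF A AY] that by blast
qed

text \<open>The columns of \<open>A * S\<close> are a basis of the column space of \<open>A\<close>. That the left factor is
  a multiple of \<open>A\<close> itself is what produces generalized inverses below.\<close>

lemma full_rank_factorization:
  assumes A: "A \<in> carrier_mat n m"
  obtains S Y where "S \<in> carrier_mat m (mat_rank A)" "Y \<in> carrier_mat (mat_rank A) m"
    "A = A * S * Y"
proof -
  interpret vec_space "TYPE('a)" n .
  obtain U where U: "U \<subseteq> set (cols A)" "lin_indpt U" "card U = mat_rank A"
    using ex_indpt_cols_card_rank[OF A] A by (auto simp: mat_rank_def)
  then have "finite U" by (meson finite_set finite_subset)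
  then obtain us where us: "set us = U" "length us = mat_rank A"
    using U(3) by (metis finite_distinct_list distinct_card)
  let ?B = "mat_of_cols n us"
  have cols: "set (cols A) \<subseteq> carrier_vec n" using cols_dim[of A] A by auto
  have colsB: "set (cols ?B) = U" using us U(1) cols by (simp add: cols_mat_of_cols)
  have B: "?B \<in> carrier_mat n (mat_rank A)" using us by auto
  have UA: "U \<subseteq> span (set (cols A))" using U(1) in_own_span[of "set (cols A)"] cols by simp
  obtain S where S: "S \<in> carrier_mat m (mat_rank A)" "?B = A * S"
    using ex_mult_if_cols_in_col_space[OF B A] UA colsB by auto
  have "set (cols A) \<subseteq> span (set (cols ?B))"
    using col_space_le_span_indpt[OF A UA U(2)] U(3) A by (simp add: colsB mat_rank_def)
  then obtain Y where "Y \<in> carrier_mat (mat_rank A) m" "A = ?B * Y"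
    using ex_mult_if_cols_in_col_space[OF A B] by auto
  with S show ?thesis using that by metis
qed

text \<open>By the factorization above, the transpose of \<open>A\<close> is a product whose left factor \<open>Y\<^sup>T\<close> has only
  \<open>mat_rank A\<close> columns. With rank invariant under transposition, each statement about right factors
  yields the corresponding one about left factors.\<close>

lemma mat_rank_transpose_le: "mat_rank A\<^sup>T \<le> mat_rank A"
proof -
  obtain S Y where S: "S \<in> carrier_mat (dim_col A) (mat_rank A)"
    and Y: "Y \<in> carrier_mat (mat_rank A) (dim_col A)" and eq: "A = A * S * Y"
    using full_rank_factorization[of A "dim_row A" "dim_col A"] by (metis carrier_matI)
  have "A\<^sup>T = (A * S * Y)\<^sup>T" using eq by simp
  also have "\<dots> = Y\<^sup>T * (A * S)\<^sup>T"
    using S Y by (intro transpose_mult[of _ "dim_row A"]) auto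
  finally have "mat_rank A\<^sup>T \<le> mat_rank Y\<^sup>T"
    using mat_rank_mult_le_left[of "Y\<^sup>T" "dim_col A" "mat_rank A" "(A * S)\<^sup>T" "dim_row A"]
      S Y mult_carrier_mat[OF carrier_matI[OF refl refl] S]
    by simp
  also have "\<dots> \<le> mat_rank A" using mat_rank_le_dim_col[of "Y\<^sup>T"] Y by simp
  finally show ?thesis .
qed

lemma mat_rank_transpose [simp]: "mat_rank A\<^sup>T = mat_rank A"
  using mat_rank_transpose_le[of A] mat_rank_transpose_le[of "A\<^sup>T"] by simp

lemma mat_rank_mult_le_right:
  assumes "P \<in> carrier_mat n k" and "A \<in> carrier_mat k m"
  shows "mat_rank (P * A) \<le> mat_rank A"
  using mat_rank_mult_le_left[of "A\<^sup>T" m k "P\<^sup>T" n] transpose_mult[OF assms] assms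
    mat_rank_transpose[of "P * A"] by simp

lemma mat_rank_mult_right_eqE:
  assumes P: "P \<in> carrier_mat n k" and A: "A \<in> carrier_mat k m"
    and r: "mat_rank (P * A) = mat_rank A"
  obtains Z where "Z \<in> carrier_mat k n" "A = Z * (P * A)"
proof -
  have "mat_rank (A\<^sup>T * P\<^sup>T) = mat_rank A\<^sup>T"
    using r by (metis transpose_mult[OF P A] mat_rank_transpose)
  then obtain Z where Z: "Z \<in> carrier_mat n k" "A\<^sup>T = A\<^sup>T * P\<^sup>T * Z"
    using mat_rank_mult_left_eqE[of "A\<^sup>T" m k "P\<^sup>T" n] P A by auto
  have "A = (A\<^sup>T * P\<^sup>T * Z)\<^sup>T" using Z(2) by (metis Matrix.transpose_transpose)
  also have "\<dots> = Z\<^sup>T * (P * A)"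
    using transpose_mult[of "A\<^sup>T * P\<^sup>T" m n Z k] Z(1) P A transpose_mult[OF P A, symmetric]
    by simp
  finally show ?thesis using that[of "Z\<^sup>T"] Z(1) by auto
qed

text \<open>In a full rank factorization \<open>A = B Y\<close> with \<open>B = A S\<close>, the factor \<open>B\<close> has full column rank and
  therefore a left inverse \<open>L\<close>. Then \<open>S L\<close> is a generalized inverse of \<open>A\<close>, as
  \<open>A (S L) A = B L B Y = B Y = A\<close>.\<close>

lemma ex_generalized_inverse: "\<exists>X. generalized_inverse (A :: 'a::field mat) X"
proof -
  let ?n = "dim_row A" and ?m = "dim_col A" and ?k = "mat_rank A"
  obtain S Y where S: "S \<in> carrier_mat ?m ?k" and Y: "Y \<in> carrier_mat ?k ?m"
    and eq: "A = A * S * Y"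
    using full_rank_factorization[of A "dim_row A" "dim_col A"] by (metis carrier_matI)
  have A: "A \<in> carrier_mat ?n ?m" by simp
  have B: "A * S \<in> carrier_mat ?n ?k" using A S by (rule mult_carrier_mat)
  then have BT: "(A * S)\<^sup>T \<in> carrier_mat ?k ?n" by simp
  \<comment> \<open>The \<open>?k\<close> rows of \<open>(A * S)\<^sup>T\<close> are independent, so its columns generate those of the
    identity matrix; the coefficients form the transpose of a left inverse.\<close>
  have "?k \<le> mat_rank (A * S)\<^sup>T"
    using mat_rank_mult_le_left[OF B Y] eq by simp
  moreover have "mat_rank (1\<^sub>m ?k * (A * S)\<^sup>T) \<le> mat_rank (1\<^sub>m ?k :: 'a mat)"
    using BT by (intro mat_rank_mult_le_left) auto
  moreover have "mat_rank (1\<^sub>m ?k :: 'a mat) \<le> ?k"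
    using mat_rank_le_dim_col[of "1\<^sub>m ?k :: 'a mat"] by simp
  ultimately have "mat_rank (1\<^sub>m ?k * (A * S)\<^sup>T) = mat_rank (1\<^sub>m ?k :: 'a mat)"
    using left_mult_one_mat[OF BT] by simp
  then obtain Z where Z: "Z \<in> carrier_mat ?n ?k" "1\<^sub>m ?k = 1\<^sub>m ?k * (A * S)\<^sup>T * Z"
    using mat_rank_mult_left_eqE[OF one_carrier_mat BT] by blast
  have "Z\<^sup>T * (A * S) = ((A * S)\<^sup>T * Z)\<^sup>T"
    using transpose_mult[OF BT Z(1)] by simp
  also have "\<dots> = 1\<^sub>m ?k" using Z BT by (metis left_mult_one_mat transpose_one)
  finally have inv: "Z\<^sup>T * (A * S) = 1\<^sub>m ?k" .
  have ZT: "Z\<^sup>T \<in> carrier_mat ?k ?n" using Z(1) by simp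
  have "A * (S * Z\<^sup>T) * A = (A * S) * (Z\<^sup>T * A)"
    using assoc_mult_mat[OF A S ZT] assoc_mult_mat[OF B ZT A] by simp
  also have "Z\<^sup>T * A = Z\<^sup>T * (A * S * Y)" using eq by simp
  also have "\<dots> = Z\<^sup>T * (A * S) * Y" by (rule assoc_mult_mat[OF ZT B Y, symmetric])
  also have "\<dots> = Y" using inv Y by simp
  also have "A * S * Y = A" using eq by simp
  finally show ?thesis
    using S Z(1) unfolding generalized_inverse_def by (intro exI[of _ "S * Z\<^sup>T"]) auto
qed

section \<open>Selecting rows and columns\<close>

lemma submatrix_rows_eq_mult:
  "submatrix A I UNIV = submatrix (1\<^sub>m (dim_row A)) I UNIV * (A :: 'a::semiring_1 mat)"
proof (rule eq_matI)
  fix a c assume "a < dim_row (submatrix (1\<^sub>m (dim_row A)) I UNIV * A)"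
    "c < dim_col (submatrix (1\<^sub>m (dim_row A)) I UNIV * A)"
  then have a: "a < card {i. i < dim_row A \<and> i \<in> I}" and c: "c < dim_col A"
    by (auto simp: dim_submatrix)
  have row: "row (submatrix (1\<^sub>m (dim_row A)) I UNIV) a = unit_vec (dim_row A) (pick I a)"
    using a pick_le[OF a] by (intro eq_vecI) (auto simp: submatrix_def pick_UNIV)
  have "(submatrix (1\<^sub>m (dim_row A)) I UNIV * A) $$ (a, c) =
      row (submatrix (1\<^sub>m (dim_row A)) I UNIV) a \<bullet> col A c"
    using a c by (intro index_mult_mat) (auto simp: dim_submatrix)
  also have "\<dots> = A $$ (pick I a, c)"
    unfolding row using c pick_le[OF a] by simp
  also have "\<dots> = submatrix A I UNIV $$ (a, c)"
    using a c by (simp add: submatrix_index pick_UNIV)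
  finally show "submatrix A I UNIV $$ (a, c) = (submatrix (1\<^sub>m (dim_row A)) I UNIV * A) $$ (a, c)" ..
qed (auto simp: dim_submatrix)

lemma reindexed_cols_eq_mult:
  fixes A B :: "'a::semiring_1 mat"
  assumes A: "A \<in> carrier_mat n m" and B: "B \<in> carrier_mat n k"
    and g: "\<And>a c. a < n \<Longrightarrow> c < k \<Longrightarrow> g c < m"
    and eq: "\<And>a c. a < n \<Longrightarrow> c < k \<Longrightarrow> B $$ (a, c) = A $$ (a, g c)"
  shows "\<exists>S \<in> carrier_mat m k. B = A * S"
proof (intro bexI[of _ "mat_of_cols m (map (\<lambda>c. unit_vec m (g c)) [0..<k])"] eq_matI)
  fix a c assume "a < dim_row (A * mat_of_cols m (map (\<lambda>c. unit_vec m (g c)) [0..<k]))"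
    "c < dim_col (A * mat_of_cols m (map (\<lambda>c. unit_vec m (g c)) [0..<k]))"
  then have "a < n" "c < k" using A by auto
  then show "B $$ (a, c) = (A * mat_of_cols m (map (\<lambda>c. unit_vec m (g c)) [0..<k])) $$ (a, c)"
    using A g[of a c] eq by (simp add: col_mat_of_cols)
qed (use A B in auto)

text \<open>This is where the generalized inverse of a submatrix does its work. If selecting rows by \<open>P\<close>
  does not lower the rank of \<open>C\<close>, then \<open>C\<close> is a left multiple \<open>Z U\<close> of \<open>U = P C\<close>, so that
  \<open>C V U = Z U V U = Z U = C\<close>. Every matrix \<open>C X\<close> with columns in the column space of \<open>C\<close> is then
  recovered from its selected rows.\<close>

lemma generalized_inverse_sketch:
  fixes P C X :: "'a::field mat"
  assumes P: "P \<in> carrier_mat k n" and C: "C \<in> carrier_mat n l" and X: "X \<in> carrier_mat l m"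
    and r: "mat_rank (P * C) = mat_rank C" and V: "generalized_inverse (P * C) V"
  shows "C * V * (P * (C * X)) = C * X"
proof -
  let ?U = "P * C"
  have U: "?U \<in> carrier_mat k l" using P C by simp
  have Vc: "V \<in> carrier_mat l k" and UVU: "?U * V * ?U = ?U"
    using V P C by (auto simp: generalized_inverse_def)
  obtain Z where Z: "Z \<in> carrier_mat n k" and CZ: "C = Z * ?U"
    using mat_rank_mult_right_eqE[OF P C r] .
  have "C * V * ?U = Z * ?U * V * ?U" using CZ by simp
  also have "\<dots> = Z * (?U * V * ?U)"
    using Z U Vc assoc_mult_mat[OF Z U Vc] assoc_mult_mat[OF Z mult_carrier_mat[OF U Vc] U] by simp
  also have "\<dots> = C" using UVU CZ by simp
  finally have "C * V * ?U = C" .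
  then show ?thesis
    using assoc_mult_mat[OF P C X] assoc_mult_mat[OF mult_carrier_mat[OF C Vc] U X] by simp
qed

section \<open>Entries of mode products\<close>

definition column_index ::
  "(nat \<Rightarrow> nat list \<Rightarrow> nat \<Rightarrow> nat list) \<Rightarrow> nat \<Rightarrow> nat list \<Rightarrow> nat list \<Rightarrow> nat" where
  "column_index \<phi> i es = inv_into {0..<prod_list es} (\<phi> i es)"

lemma column_index:
  assumes "column_numbering \<phi>" and "js \<in> multi_indices es"
  shows "column_index \<phi> i es js < prod_list es" and "\<phi> i es (column_index \<phi> i es js) = js"
proof -
  have js: "js \<in> \<phi> i es ` {0..<prod_list es}"
    using assms by (simp add: column_numbering_def bij_betw_def)
  show "column_index \<phi> i es js < prod_list es" "\<phi> i es (column_index \<phi> i es js) = js"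
    using inv_into_into[OF js] f_inv_into_f[OF js] by (simp_all add: column_index_def)
qed

lemma column_in_multi_indices:
  assumes "column_numbering \<phi>" and "c < prod_list es"
  shows "\<phi> i es c \<in> multi_indices es"
  using assms bij_betw_apply[of "\<phi> i es"] unfolding column_numbering_def by fastforce

lemma length_multi_index: "js \<in> multi_indices es \<Longrightarrow> length js = length es"
  by (simp add: multi_indices_def)

lemma nth_multi_index: "js \<in> multi_indices es \<Longrightarrow> j < length es \<Longrightarrow> js ! j < es ! j"
  by (simp add: multi_indices_def)

lemma multi_index_update:
  assumes m: "is \<in> multi_indices (ds[i := m])" and k: "k < ds ! i"
  shows "is[i := k] \<in> multi_indices ds"
proof -
  have "is[i := k] ! j < ds ! j" if "j < length ds" for j
    using m k that by (cases "j = i") (auto simp: multi_indices_def)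
  then show ?thesis using m by (simp add: multi_indices_def)
qed

lemma unfolding_mat_entry:
  assumes \<phi>: "column_numbering \<phi>" and i: "i < order_tensor T"
    and m: "is \<in> multi_indices (dims T)"
  shows "unfolding_mat \<phi> i T $$ (is ! i, column_index \<phi> i (remove_nth i (dims T)) (remove_nth i is)) =
    entry T is"
  using column_index[OF \<phi> remove_nth_multi_indices[OF m, of i], of i] i m
  by (simp add: unfolding_mat_def insert_remove_nth order_tensor_def multi_indices_def)

lemma insert_nth_eq_update:
  "i < length is \<Longrightarrow> insert_nth i k (remove_nth i is) = is[i := k]"
  by (metis insert_remove_nth length_list_update nth_list_update_eq remove_nth_update)

text \<open>Entrywise, a mode product does not depend on the numbering of the columns. This form compares
  products and unfoldings in different modes, whose columns are numbered by unrelated bijections.\<close>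

lemma entry_mode_product:
  assumes \<phi>: "column_numbering \<phi>" and i: "i < order_tensor T"
    and Y: "dim_col Y = dims T ! i"
    and m: "is \<in> multi_indices ((dims T)[i := dim_row Y])"
  shows "entry (mode_product \<phi> i T Y) is =
    (\<Sum>k<dims T ! i. Y $$ (is ! i, k) * entry T (is[i := k]))"
proof -
  let ?P = "mode_product \<phi> i T Y" and ?es = "remove_nth i (dims T)"
  let ?c = "column_index \<phi> i ?es (remove_nth i is)"
  have dP: "dims ?P = (dims T)[i := dim_row Y]" by (rule mode_product[OF \<phi> i])
  have i': "i < length (dims T)" "i < length is"
    using i m by (auto simp: order_tensor_def multi_indices_def)
  have a: "is ! i < dim_row Y" using nth_multi_index[OF m, of i] i' by simp
  have rm: "remove_nth i is \<in> multi_indices ?es"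
    using remove_nth_multi_indices[OF m, of i] by simp
  note c = column_index[OF \<phi> rm, of i]
  have "entry ?P is = unfolding_mat \<phi> i ?P $$ (is ! i, ?c)"
    using unfolding_mat_entry[OF \<phi>, of i ?P "is"] i m by (simp add: dP order_tensor_def)
  also have "\<dots> = (Y * unfolding_mat \<phi> i T) $$ (is ! i, ?c)"
    by (simp add: mode_product[OF \<phi> i])
  also have "\<dots> = (\<Sum>k<dims T ! i. Y $$ (is ! i, k) * entry T (is[i := k]))"
    using a c Y i' by (simp add: scalar_prod_def unfolding_mat_def insert_nth_eq_update lessThan_atLeast0)
  finally show ?thesis .
qed

text \<open>Once the \<open>i\<close>-th dimension is removed, mode \<open>j\<close> stands at position \<open>j\<close> or \<open>j - 1\<close>, according to
  whether it comes before or after \<open>i\<close>.\<close>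

lemma insert_nth_update:
  assumes "i \<noteq> j" and i: "i \<le> length js"
  shows "(insert_nth i a js)[j := k] = insert_nth i a (js[(if j < i then j else j - 1) := k])"
proof (cases "j < i")
  case True
  with i show ?thesis
    by (simp add: insert_nth_def list_update_append take_update_swap)
next
  case False
  with assms obtain l where "j = i + Suc l"
    using less_imp_Suc_add[of i j] by auto
  with i show ?thesis
    by (simp add: insert_nth_def list_update_append drop_update_swap)
qed

lemma insert_nth_neq:
  assumes "i \<noteq> j" and i: "i \<le> length js"
  shows "insert_nth i a js ! j = js ! (if j < i then j else j - 1)"
proof (cases "j < i")
  case True
  with i show ?thesis by (simp add: insert_nth_def nth_append)
next
  case False
  with assms obtain l where "j = i + Suc l"
    using less_imp_Suc_add[of i j] by auto
  with i show ?thesis by (simp add: insert_nth_def nth_append)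
qed

section \<open>Unfoldings of mode products\<close>

lemma unfolding_mat_carrier:
  "unfolding_mat \<phi> i T \<in> carrier_mat (dims T ! i) (prod_list (remove_nth i (dims T)))"
  by (simp add: unfolding_mat_def)

lemma unfolding_mat_index:
  assumes "a < dims T ! i" and "c < prod_list (remove_nth i (dims T))"
  shows "unfolding_mat \<phi> i T $$ (a, c) = entry T (insert_nth i a (\<phi> i (remove_nth i (dims T)) c))"
  using assms by (simp add: unfolding_mat_def)

text \<open>A mode product in a mode \<open>j \<noteq> i\<close> replaces the columns of the mode-\<open>i\<close> unfolding by linear
  combinations of them, with coefficients that are the same for all rows.\<close>

lemma unfolding_mode_product_other:
  fixes T :: "'a::comm_semiring_1 tensor"
  assumes \<phi>: "column_numbering \<phi>" and i: "i < order_tensor T" and j: "j < order_tensor T"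
    and ne: "i \<noteq> j" and Y: "dim_col Y = dims T ! j"
  shows "\<exists>K \<in> carrier_mat (prod_list (remove_nth i (dims T)))
      (prod_list (remove_nth i ((dims T)[j := dim_row Y]))).
    unfolding_mat \<phi> i (mode_product \<phi> j T Y) = unfolding_mat \<phi> i T * K"
proof -
  let ?ds = "dims T" and ?ds' = "(dims T)[j := dim_row Y]" and ?P = "mode_product \<phi> j T Y"
  let ?es = "remove_nth i ?ds" and ?es' = "remove_nth i ?ds'"
  let ?M = "unfolding_mat \<phi> i T"
  define j' where "j' = (if j < i then j else j - 1)"
  define col where "col c k = column_index \<phi> i ?es ((\<phi> i ?es' c)[j' := k])" for c k
  \<comment> \<open>The column with remaining indices \<open>js\<close> becomes the combination, with coefficients
    \<open>Y $$ (js ! j', k)\<close>, of the columns whose remaining indices are \<open>js\<close> with \<open>k\<close> in mode \<open>j\<close>.\<close>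
  define K where "K = mat (prod_list ?es) (prod_list ?es')
    (\<lambda>(l, c). \<Sum>k<?ds ! j. if l = col c k then Y $$ (\<phi> i ?es' c ! j', k) else 0)"
  have dP: "dims ?P = ?ds'" by (rule mode_product[OF \<phi> j])
  have len: "i < length ?ds" "j < length ?ds" using i j by (auto simp: order_tensor_def)
  have "unfolding_mat \<phi> i ?P = ?M * K"
  proof (rule eq_matI)
    fix a c assume "a < dim_row (?M * K)" "c < dim_col (?M * K)"
    then have a: "a < ?ds ! i" and c: "c < prod_list ?es'"
      by (auto simp: K_def unfolding_mat_def)
    let ?js = "\<phi> i ?es' c"
    have js: "?js \<in> multi_indices ?es'" using column_in_multi_indices[OF \<phi> c] .
    have ljs: "i \<le> length ?js" "j \<le> length ?js"
      using len length_multi_index[OF js] by (auto simp: remove_nth_def)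
    have ins: "insert_nth i a ?js \<in> multi_indices ?ds'"
      using insert_nth_multi_indices[of i ?ds' a] js a ne len by simp
    have upd: "(insert_nth i a ?js)[j := k] = insert_nth i a (?js[j' := k])" for k
      unfolding j'_def using insert_nth_update[OF ne ljs(1)] .
    have ent: "entry T ((insert_nth i a ?js)[j := k]) = ?M $$ (a, col c k)"
      and colb: "col c k < prod_list ?es" if k: "k < ?ds ! j" for k
    proof -
      have mi: "(insert_nth i a ?js)[j := k] \<in> multi_indices ?ds"
        using multi_index_update[OF ins k] .
      have rm: "remove_nth i ((insert_nth i a ?js)[j := k]) = ?js[j' := k]"
        unfolding upd using ljs by simp
      show "col c k < prod_list ?es"
        using column_index[OF \<phi> remove_nth_multi_indices[OF mi, of i], of i] rm
        by (simp add: col_def)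
      show "entry T ((insert_nth i a ?js)[j := k]) = ?M $$ (a, col c k)"
        using unfolding_mat_entry[OF \<phi> i mi] rm ne ljs
        by (simp add: col_def insert_nth_same)
    qed
    have "unfolding_mat \<phi> i ?P $$ (a, c) = entry ?P (insert_nth i a ?js)"
      using a c ne by (simp add: unfolding_mat_def dP)
    also have "\<dots> = (\<Sum>k<?ds ! j. Y $$ (?js ! j', k) * ?M $$ (a, col c k))"
      using entry_mode_product[OF \<phi> j Y ins] ent insert_nth_neq[OF ne ljs(1)]
      by (simp add: j'_def)
    also have "\<dots> = (\<Sum>k<?ds ! j. \<Sum>l<prod_list ?es.
        ?M $$ (a, l) * (if l = col c k then Y $$ (?js ! j', k) else 0))"
      using colb by (intro sum.cong refl) (simp add: if_distrib mult.commute cong: if_cong)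
    also have "\<dots> = (\<Sum>l<prod_list ?es. ?M $$ (a, l) * K $$ (l, c))"
      using c by (subst sum.swap) (simp add: K_def sum_distrib_left)
    also have "\<dots> = (?M * K) $$ (a, c)"
      using a c by (simp add: K_def unfolding_mat_def scalar_prod_def lessThan_atLeast0)
    finally show "unfolding_mat \<phi> i ?P $$ (a, c) = (?M * K) $$ (a, c)" .
  qed (use ne in \<open>auto simp: K_def unfolding_mat_def dP\<close>)
  then show ?thesis by (intro bexI[of _ K]) (auto simp: K_def)
qed

lemma unfolding_mode_products:
  fixes T :: "'a::comm_semiring_1 tensor"
  assumes \<phi>: "column_numbering \<phi>" and i: "i < order_tensor T"
    and Y: "\<And>j. j < order_tensor T \<Longrightarrow> dim_col (Y j) = dims T ! j"
  shows "\<exists>m. \<exists>K \<in> carrier_mat (prod_list (remove_nth i (dims T))) m.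
    unfolding_mat \<phi> i (mode_products \<phi> T Y) = Y i * unfolding_mat \<phi> i T * K"
proof -
  let ?S = "\<lambda>l. fold (\<lambda>j S. mode_product \<phi> j S (Y j)) [0..<l] T"
  let ?es = "\<lambda>l. remove_nth i (dims (?S l))"
  let ?M = "\<lambda>l. unfolding_mat \<phi> i (?S l)"
  define X where "X l = (if l \<le> i then ?M 0 else Y i * ?M 0)" for l
  \<comment> \<open>\<open>?S l\<close> is the tensor after the first \<open>l\<close> products. The factor \<open>Y i\<close> enters its mode-\<open>i\<close> unfolding
    in step \<open>i\<close>; every other step only contributes to the right factor.\<close>
  have "length (dims (?S l)) = length (dims T) \<and> (\<forall>j. l \<le> j \<longrightarrow> dims (?S l) ! j = dims T ! j) \<and>
      (\<exists>K \<in> carrier_mat (prod_list (?es 0)) (prod_list (?es l)). ?M l = X l * K)"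
    if "l \<le> order_tensor T" for l
    using that
  proof (induction l)
    case 0
    show ?case using unfolding_mat_carrier[of \<phi> i T]
      by (auto simp: X_def intro!: bexI[of _ "1\<^sub>m (prod_list (?es 0))"])
  next
    case (Suc l)
    then obtain K where len: "length (dims (?S l)) = length (dims T)"
      and d: "\<And>j. l \<le> j \<Longrightarrow> dims (?S l) ! j = dims T ! j"
      and K: "K \<in> carrier_mat (prod_list (?es 0)) (prod_list (?es l))" "?M l = X l * K"
      by auto
    have l: "l < order_tensor (?S l)" and i': "i < order_tensor (?S l)"
      using Suc.prems i len by (simp_all add: order_tensor_def)
    have S: "?S (Suc l) = mode_product \<phi> l (?S l) (Y l)" by simp
    have ds: "dims (?S (Suc l)) = (dims (?S l))[l := dim_row (Y l)]"
      unfolding S by (rule mode_product[OF \<phi> l])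
    have T0: "?M 0 \<in> carrier_mat (dims T ! i) (prod_list (?es 0))"
      using unfolding_mat_carrier by simp
    have Yl: "dim_col (Y l) = dims T ! l" using Y Suc.prems by simp
    have "\<exists>K \<in> carrier_mat (prod_list (?es 0)) (prod_list (?es (Suc l))). ?M (Suc l) = X (Suc l) * K"
    proof (cases "l = i")
      case True
      have Yi: "Y i \<in> carrier_mat (dim_row (Y i)) (dims T ! i)" using Yl True by auto
      have "?M (Suc l) = Y i * ?M l"
        unfolding S using mode_product(2)[OF \<phi> l] True by simp
      also have "\<dots> = Y i * ?M 0 * K"
        using K(2) assoc_mult_mat[OF Yi T0 K(1)] True by (simp add: X_def)
      finally show ?thesis using K(1) True unfolding ds by (auto simp: X_def)
    next
      case False
      obtain L where L: "L \<in> carrier_mat (prod_list (?es l)) (prod_list (?es (Suc l)))"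
        "?M (Suc l) = ?M l * L"
        using unfolding_mode_product_other[OF \<phi> i' l, of "Y l"] False Yl d unfolding S[symmetric] ds
        by auto
      have XS: "X (Suc l) = X l" using False by (auto simp: X_def)
      have "X l \<in> carrier_mat (dim_row (X l)) (prod_list (?es 0))"
        using T0 by (auto simp: X_def)
      then have "?M (Suc l) = X (Suc l) * (K * L)"
        using L(2) K assoc_mult_mat[OF _ K(1) L(1)] XS by simp
      then show ?thesis using K(1) L(1) by (intro bexI[of _ "K * L"]) auto
    qed
    then show ?case using d len unfolding ds by simp
  qed
  from this[of "order_tensor T"] show ?thesis
    using i by (auto simp: X_def mode_products_def)
qed

lemma mode_product_fixed:
  assumes \<phi>: "column_numbering \<phi>" and i: "i < order_tensor T"
    and "dim_row Y = dims T ! i" and "Y * unfolding_mat \<phi> i T = unfolding_mat \<phi> i T"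
  shows "mode_product \<phi> i T Y = T"
  using mode_product[OF \<phi> i, of Y] assms
  by (intro unfolding_mat_inject[OF \<phi> i]) auto

lemma mode_products_fixed:
  assumes \<phi>: "column_numbering \<phi>"
    and Y: "\<And>i. i < order_tensor T \<Longrightarrow> dim_row (Y i) = dims T ! i"
    and inv: "\<And>i. i < order_tensor T \<Longrightarrow> Y i * unfolding_mat \<phi> i T = unfolding_mat \<phi> i T"
  shows "mode_products \<phi> T Y = T"
proof -
  have "fold (\<lambda>i S. mode_product \<phi> i S (Y i)) [0..<l] T = T" if "l \<le> order_tensor T" for l
    using that by (induction l) (simp_all add: mode_product_fixed[OF \<phi>] Y inv)
  then show ?thesis by (simp add: mode_products_def)
qed

section \<open>Subtensors\<close>

lemma dims_subtensor:
  "dims (subtensor T I) = map (\<lambda>j. card {k. k < dims T ! j \<and> k \<in> I j}) [0..<order_tensor T]"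
  by (simp add: subtensor_def)

lemma order_subtensor [simp]: "order_tensor (subtensor T I) = order_tensor T"
  by (simp add: order_tensor_def dims_subtensor)

lemma entry_subtensor:
  "ks \<in> multi_indices (dims (subtensor T I)) \<Longrightarrow>
    entry (subtensor T I) ks = entry T (map (\<lambda>j. pick (I j) (ks ! j)) [0..<order_tensor T])"
  by (simp add: subtensor_def)

lemma pick_multi_index:
  assumes "ks \<in> multi_indices (dims (subtensor T I))"
  shows "map (\<lambda>j. pick (I j) (ks ! j)) [0..<order_tensor T] \<in> multi_indices (dims T)"
  using assms by (auto simp: multi_indices_def dims_subtensor order_tensor_def intro: pick_le)

lemma subtensor_cong:
  "(\<And>j. j < order_tensor T \<Longrightarrow> I j = I' j) \<Longrightarrow> subtensor T I = subtensor T I'"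
  unfolding subtensor_def by (auto intro!: arg_cong2[of _ _ _ _ mk_tensor] arg_cong[of _ _ "entry T"])

lemma subtensor_UNIV:
  "subtensor T (\<lambda>_. UNIV) = T"
proof (rule tensor_eqI)
  show d: "dims (subtensor T (\<lambda>_. UNIV)) = dims T"
    by (simp add: dims_subtensor order_tensor_def map_nth)
  fix ks assume ks: "ks \<in> multi_indices (dims T)"
  then have "length ks = order_tensor T" by (simp add: multi_indices_def order_tensor_def)
  then have "map (\<lambda>j. pick UNIV (ks ! j)) [0..<order_tensor T] = ks"
    by (auto simp: pick_UNIV intro: nth_equalityI)
  then show "entry (subtensor T (\<lambda>_. UNIV)) ks = entry T ks"
    using ks by (simp add: entry_subtensor d)
qed

text \<open>If \<open>A\<close> recovers the mode-\<open>i\<close> unfolding of \<open>T\<close> from the rows in \<open>I i\<close>, then it recovers every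
  mode-\<open>i\<close> fibre of \<open>T\<close> from its entries in \<open>I i\<close>. The fibres of a subtensor are parts of fibres
  of \<open>T\<close>, whatever the restrictions in the other modes are.\<close>

lemma mode_product_subtensor:
  assumes \<phi>: "column_numbering \<phi>" and i: "i < order_tensor T"
    and A: "A \<in> carrier_mat (dims T ! i) (card {k. k < dims T ! i \<and> k \<in> I i})"
    and eq: "A * submatrix (unfolding_mat \<phi> i T) (I i) UNIV = unfolding_mat \<phi> i T"
  shows "mode_product \<phi> i (subtensor T I) A = subtensor T (I(i := UNIV))"
proof (rule tensor_eqI)
  let ?R = "subtensor T I" and ?R' = "subtensor T (I(i := UNIV))" and ?M = "unfolding_mat \<phi> i T"
  let ?m = "card {k. k < dims T ! i \<and> k \<in> I i}"
  have iR: "i < order_tensor ?R" using i by simp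
  have dR: "dims ?R ! i = ?m" using i by (simp add: dims_subtensor)
  have dR': "dims ?R' = (dims ?R)[i := dim_row A]"
    using i A by (auto simp: dims_subtensor nth_list_update intro!: nth_equalityI)
  then show "dims (mode_product \<phi> i ?R A) = dims ?R'"
    using mode_product(1)[OF \<phi> iR] by simp
  fix ks assume ks': "ks \<in> multi_indices (dims ?R')"
  then have ks: "ks \<in> multi_indices ((dims ?R)[i := dim_row A])" using dR' by simp
  \<comment> \<open>\<open>ls\<close> is the position in \<open>T\<close> of the entry \<open>ks\<close>, and \<open>?c\<close> the column of the unfolding, that
    is, the fibre of \<open>T\<close>, on which it lies.\<close>
  define ls where "ls = map (\<lambda>j. pick ((I(i := UNIV)) j) (ks ! j)) [0..<order_tensor T]"
  have ls: "ls \<in> multi_indices (dims T)" unfolding ls_def using pick_multi_index[OF ks'] .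
  have lks: "length ks = order_tensor T"
    using length_multi_index[OF ks] by (simp add: dims_subtensor)
  have lsi: "ls ! i = ks ! i" using i by (simp add: ls_def pick_UNIV)
  have a: "ks ! i < dims T ! i"
    using nth_multi_index[OF ls, of i] lsi i by (simp add: order_tensor_def)
  let ?c = "column_index \<phi> i (remove_nth i (dims T)) (remove_nth i ls)"
  have c: "?c < prod_list (remove_nth i (dims T))"
    using column_index(1)[OF \<phi> remove_nth_multi_indices[OF ls]] .
  have ent: "entry ?R (ks[i := k]) = ?M $$ (pick (I i) k, ?c)" if k: "k < ?m" for k
  proof -
    have "ks[i := k] \<in> multi_indices (dims ?R)"
      using multi_index_update[OF ks] k dR by simp
    moreover have "map (\<lambda>j. pick (I j) (ks[i := k] ! j)) [0..<order_tensor T] = ls[i := pick (I i) k]"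
      using i lks by (auto simp: ls_def nth_list_update intro!: nth_equalityI)
    ultimately have "entry ?R (ks[i := k]) = entry T (ls[i := pick (I i) k])"
      by (simp add: entry_subtensor)
    also have "\<dots> = ?M $$ (pick (I i) k, ?c)"
      using unfolding_mat_entry[OF \<phi> i, of "ls[i := pick (I i) k]"] ls pick_le[OF k] i
        multi_index_update[of ls "dims T" i "dims T ! i" "pick (I i) k"] length_multi_index[OF ls]
      by (simp add: order_tensor_def)
    finally show ?thesis .
  qed
  have "entry (mode_product \<phi> i ?R A) ks = (\<Sum>k<?m. A $$ (ks ! i, k) * entry ?R (ks[i := k]))"
    using entry_mode_product[OF \<phi> iR _ ks] A dR by simp
  also have "\<dots> = (\<Sum>k<?m. A $$ (ks ! i, k) * ?M $$ (pick (I i) k, ?c))"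
    using ent by simp
  also have "\<dots> = (A * submatrix ?M (I i) UNIV) $$ (ks ! i, ?c)"
    using a c A unfolding_mat_carrier[of \<phi> i T]
    by (simp add: scalar_prod_def dim_submatrix submatrix_index pick_UNIV lessThan_atLeast0)
  also have "\<dots> = entry T ls"
    using unfolding_mat_entry[OF \<phi> i ls] by (simp add: eq lsi)
  also have "\<dots> = entry ?R' ks" using ks' by (simp add: entry_subtensor ls_def)
  finally show "entry (mode_product \<phi> i ?R A) ks = entry ?R' ks" .
qed

lemma mode_products_subtensor:
  assumes \<phi>: "column_numbering \<phi>"
    and A: "\<And>i. i < order_tensor T \<Longrightarrow>
      A i \<in> carrier_mat (dims T ! i) (card {k. k < dims T ! i \<and> k \<in> I i})"
    and eq: "\<And>i. i < order_tensor T \<Longrightarrow>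
      A i * submatrix (unfolding_mat \<phi> i T) (I i) UNIV = unfolding_mat \<phi> i T"
  shows "mode_products \<phi> (subtensor T I) A = T"
proof -
  \<comment> \<open>After \<open>l\<close> products the first \<open>l\<close> modes are complete and the others still restricted.\<close>
  have "fold (\<lambda>i S. mode_product \<phi> i S (A i)) [0..<l] (subtensor T I) =
      subtensor T (\<lambda>j. if j < l then UNIV else I j)" if "l \<le> order_tensor T" for l
    using that
  proof (induction l)
    case (Suc l)
    have "(\<lambda>j. if j < l then UNIV else I j)(l := UNIV) = (\<lambda>j. if j < Suc l then UNIV else I j)"
      by (rule ext) auto
    then show ?case
      using Suc mode_product_subtensor[OF \<phi>, of l T "A l" "\<lambda>j. if j < l then UNIV else I j"] A eq
      by simp
  qed simp
  then have "mode_products \<phi> (subtensor T I) A =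
      subtensor T (\<lambda>j. if j < order_tensor T then UNIV else I j)"
    by (simp add: mode_products_def)
  also have "\<dots> = subtensor T (\<lambda>_. UNIV)" by (rule subtensor_cong) simp
  finally show ?thesis by (simp add: subtensor_UNIV)
qed

text \<open>The columns of the unfolding of a subtensor are fibres of \<open>T\<close> cut down to the rows in \<open>I i\<close>. The
  restrictions in the other modes only select which fibres occur.\<close>

lemma unfolding_subtensor:
  fixes T :: "'a::semiring_1 tensor"
  assumes \<phi>: "column_numbering \<phi>" and i: "i < order_tensor T"
  shows "\<exists>m. \<exists>S \<in> carrier_mat (prod_list (remove_nth i (dims T))) m.
    unfolding_mat \<phi> i (subtensor T I) = submatrix (unfolding_mat \<phi> i T) (I i) UNIV * S"
proof -
  let ?R = "subtensor T I"
  let ?es = "remove_nth i (dims T)" and ?es' = "remove_nth i (dims ?R)"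
  let ?N = "submatrix (unfolding_mat \<phi> i T) (I i) UNIV"
  let ?m = "card {k. k < dims T ! i \<and> k \<in> I i}"
  define p where "p ks = map (\<lambda>j. pick (I j) (ks ! j)) [0..<order_tensor T]" for ks
  \<comment> \<open>\<open>g c\<close> is the column of the unfolding of \<open>T\<close> that column \<open>c\<close> comes from. The index 0 inserted
    in mode \<open>i\<close> is a placeholder that is removed again.\<close>
  define g where "g c = column_index \<phi> i ?es (remove_nth i (p (insert_nth i 0 (\<phi> i ?es' c))))" for c
  have dR: "dims ?R ! i = ?m" using i by (simp add: dims_subtensor)
  have g: "g c < prod_list ?es"
    and ent: "unfolding_mat \<phi> i ?R $$ (a, c) = ?N $$ (a, g c)"
    if a: "a < ?m" and c: "c < prod_list ?es'" for a c
  proof -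
    let ?js = "\<phi> i ?es' c"
    let ?ks = "insert_nth i a ?js"
    have js: "?js \<in> multi_indices ?es'" using column_in_multi_indices[OF \<phi> c] .
    have ljs: "i \<le> length ?js"
      using i length_multi_index[OF js] by (simp add: remove_nth_def dims_subtensor)
    have ks: "?ks \<in> multi_indices (dims ?R)"
      using insert_nth_multi_indices[of i "dims ?R" a] js a i dR by (simp add: dims_subtensor)
    have pks: "p ?ks \<in> multi_indices (dims T)"
      unfolding p_def using pick_multi_index[OF ks] .
    have "insert_nth i 0 ?js = ?ks[i := 0]"
      using ljs by (simp add: insert_nth_def list_update_append)
    moreover have "p (?ks[i := 0]) = (p ?ks)[i := pick (I i) 0]"
      using i length_multi_index[OF ks]
      by (auto simp: p_def nth_list_update dims_subtensor intro!: nth_equalityI)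
    ultimately have gc: "g c = column_index \<phi> i ?es (remove_nth i (p ?ks))"
      by (simp add: g_def)
    then show gb: "g c < prod_list ?es"
      using column_index[OF \<phi> remove_nth_multi_indices[OF pks]] by simp
    have "p ?ks ! i = pick (I i) a"
      using i ljs by (simp add: p_def insert_nth_same)
    then have "unfolding_mat \<phi> i T $$ (pick (I i) a, g c) = entry T (p ?ks)"
      using unfolding_mat_entry[OF \<phi> i pks] gc by simp
    also have "\<dots> = unfolding_mat \<phi> i ?R $$ (a, c)"
      using a c dR entry_subtensor[OF ks] by (simp add: unfolding_mat_index p_def)
    finally show "unfolding_mat \<phi> i ?R $$ (a, c) = ?N $$ (a, g c)"
      using a gb unfolding_mat_carrier[of \<phi> i T] by (simp add: submatrix_index pick_UNIV)
  qed
  have "\<exists>S \<in> carrier_mat (prod_list ?es) (prod_list ?es'). unfolding_mat \<phi> i ?R = ?N * S"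
    using g ent unfolding_mat_carrier[of \<phi> i T] unfolding_mat_carrier[of \<phi> i ?R] dR
    by (intro reindexed_cols_eq_mult[of _ ?m]) (auto simp: dim_submatrix)
  then show ?thesis by blast
qed


section \<open>The equivalence\<close>

theorem theorem4p1:
  fixes T R :: "'a::field tensor"
    and d r :: "nat list"
    and n :: nat
    and I J :: "nat \<Rightarrow> nat set"
    and C U :: "nat \<Rightarrow> 'a mat"
    and \<phi> :: "nat \<Rightarrow> nat list \<Rightarrow> nat \<Rightarrow> nat list"
  assumes "column_numbering \<phi>"
    and "length d = n"
    and "dims T = d"
    and "has_multilinear_rank \<phi> T r"
    and "\<And>i. i < n \<Longrightarrow> I i \<subseteq> {0..<d ! i}"
    and "\<And>i. i < n \<Longrightarrow> J i \<subseteq> {0..<prod_list (remove_nth i d)}"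
    and "R = subtensor T I"
    and "\<And>i. i < n \<Longrightarrow> C i = submatrix (unfolding_mat \<phi> i T) UNIV (J i)"
    and "\<And>i. i < n \<Longrightarrow> U i = submatrix (C i) (I i) UNIV"
  shows "let
       S1 = (\<forall>i<n. mat_rank (U i) = r ! i);
       S2 = (\<exists>V. (\<forall>i<n. generalized_inverse (U i) (V i)) \<and>
                 T = mode_products \<phi> R (\<lambda>i. C i * V i));
       S3 = (\<forall>V. (\<forall>i<n. generalized_inverse (U i) (V i)) \<longrightarrow>
                 T = mode_products \<phi> R (\<lambda>i. C i * V i));
       S4 = ((\<forall>i<n. mat_rank (C i) = r ! i) \<and> has_multilinear_rank \<phi> R r)
     in (S1 \<longleftrightarrow> S2) \<and> (S2 \<longleftrightarrow> S3) \<and> (S3 \<longleftrightarrow> S4) \<and>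
        (S1 \<or> S2 \<or> S3 \<or> S4 \<longrightarrow>
          (\<forall>W. (\<forall>i<n. generalized_inverse (C i) (W i)) \<longrightarrow>
               T = mode_products \<phi> T (\<lambda>i. C i * W i)))"
proof -
  note \<phi> = assms(1) and R = assms(7)
  have n: "order_tensor T = n" using assms(2,3) by (simp add: order_tensor_def)
  define M where "M i = unfolding_mat \<phi> i T" for i
  define N where "N i = unfolding_mat \<phi> i R" for i
  define p where "p i = card {k. k < d ! i \<and> k \<in> I i}" for i
  define q where "q i = prod_list (remove_nth i d)" for i
  define l where "l i = dim_col (C i)" for i
  define P :: "nat \<Rightarrow> 'a mat" where "P i = submatrix (1\<^sub>m (d ! i)) (I i) UNIV" for i
  have M: "M i \<in> carrier_mat (d ! i) (q i)" for i
    unfolding M_def q_def assms(3)[symmetric] by (rule unfolding_mat_carrier)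
  have P: "P i \<in> carrier_mat (p i) (d ! i)" for i
    by (auto simp: P_def p_def dim_submatrix intro!: carrier_matI)
  have rankM: "mat_rank (M i) = r ! i" if "i < n" for i
    using assms(4) that n by (simp add: has_multilinear_rank_def M_def)
  have C: "C i \<in> carrier_mat (d ! i) (l i)" if i: "i < n" for i
    using assms(8)[OF i] M[of i] by (auto simp: l_def M_def[symmetric] dim_submatrix)
  have lw: "l i = card {k. k < q i \<and> k \<in> J i}" if i: "i < n" for i
    using assms(8)[OF i] M[of i] by (simp add: l_def M_def[symmetric] dim_submatrix)
  have exS: "\<exists>S \<in> carrier_mat (q i) (l i). C i = M i * S" if i: "i < n" for i
    using M[of i] C[OF i] assms(8)[OF i]
    by (intro reindexed_cols_eq_mult[where g = "pick (J i)"])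
      (auto simp: M_def[symmetric] dim_submatrix submatrix_index pick_UNIV lw[OF i] intro: pick_le)
  have rankC_le: "mat_rank (C i) \<le> r ! i" if i: "i < n" for i
    using exS[OF i] mat_rank_mult_le_left[OF M] rankM[OF i] by fastforce
  have exX: "\<exists>X \<in> carrier_mat (l i) (q i). M i = C i * X"
    if i: "i < n" and r: "mat_rank (C i) = r ! i" for i
  proof -
    obtain S where S: "S \<in> carrier_mat (q i) (l i)" "C i = M i * S" using exS[OF i] by blast
    show ?thesis
      using mat_rank_mult_left_eqE[OF M S(1)] S(2) rankM[OF i] r by metis
  qed
  have U: "U i = P i * C i" if i: "i < n" for i
    using assms(9)[OF i] submatrix_rows_eq_mult[of "C i" "I i"] C[OF i] by (simp add: P_def)
  have rankU_le: "mat_rank (U i) \<le> mat_rank (C i)" if i: "i < n" for i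
    using mat_rank_mult_le_right[OF P C[OF i]] U[OF i] by simp
  have PM: "submatrix (M i) (I i) UNIV = P i * M i" for i
    using submatrix_rows_eq_mult[of "M i" "I i"] M[of i] by (simp add: P_def)
  have exN: "\<exists>m. \<exists>S \<in> carrier_mat (q i) m. N i = P i * M i * S" if "i < n" for i
    using unfolding_subtensor[OF \<phi>, of i T I] that n PM[of i] assms(3)
    by (simp add: N_def R M_def q_def)
  have rankN_le: "mat_rank (N i) \<le> mat_rank (M i)" if i: "i < n" for i
  proof -
    obtain m S where S: "S \<in> carrier_mat (q i) m" "N i = P i * M i * S" using exN[OF i] by blast
    then show ?thesis
      using mat_rank_mult_le_left[OF mult_carrier_mat[OF P M] S(1)] mat_rank_mult_le_right[OF P M]
      by (metis le_trans)
  qed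
  have orderR: "order_tensor R = n" using n by (simp add: R)
  have dimR: "dims R ! i = p i" if "i < n" for i
    using that n assms(3) by (simp add: R dims_subtensor p_def)

  let ?S1 = "\<forall>i<n. mat_rank (U i) = r ! i"
  let ?S2 = "\<exists>V. (\<forall>i<n. generalized_inverse (U i) (V i)) \<and> T = mode_products \<phi> R (\<lambda>i. C i * V i)"
  let ?S3 = "\<forall>V. (\<forall>i<n. generalized_inverse (U i) (V i)) \<longrightarrow> T = mode_products \<phi> R (\<lambda>i. C i * V i)"
  let ?S4 = "(\<forall>i<n. mat_rank (C i) = r ! i) \<and> has_multilinear_rank \<phi> R r"

  have 13: ?S3 if S1: ?S1
  proof (intro allI impI)
    fix V assume V: "\<forall>i<n. generalized_inverse (U i) (V i)"
    have "mode_products \<phi> (subtensor T I) (\<lambda>i. C i * V i) = T"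
    proof (rule mode_products_subtensor[OF \<phi>])
      fix i assume "i < order_tensor T"
      then have i: "i < n" using n by simp
      have Vi: "generalized_inverse (P i * C i) (V i)" using V i U by simp
      then show "C i * V i \<in> carrier_mat (dims T ! i) (card {k. k < dims T ! i \<and> k \<in> I i})"
        using C[OF i] P[of i] assms(3) by (auto simp: generalized_inverse_def p_def)
      have rC: "mat_rank (C i) = r ! i" "mat_rank (P i * C i) = mat_rank (C i)"
        using S1 i rankU_le[OF i] rankC_le[OF i] U[OF i] by fastforce+
      obtain X where X: "X \<in> carrier_mat (l i) (q i)" "M i = C i * X"
        using exX[OF i rC(1)] by blast
      show "C i * V i * submatrix (unfolding_mat \<phi> i T) (I i) UNIV = unfolding_mat \<phi> i T"
        using generalized_inverse_sketch[OF P C[OF i] X(1) rC(2) Vi] X(2) PM[of i]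
        by (simp add: M_def)
    qed
    then show "T = mode_products \<phi> R (\<lambda>i. C i * V i)" by (simp add: R)
  qed
  have 32: ?S2 if S3: ?S3
  proof -
    have "\<forall>i. \<exists>X. generalized_inverse (U i) X" by (intro allI ex_generalized_inverse)
    from choice[OF this] obtain V where V: "\<And>i. generalized_inverse (U i) (V i)" by blast
    then have "T = mode_products \<phi> R (\<lambda>i. C i * V i)"
      using S3[rule_format, of V] by simp
    with V show ?thesis by (intro exI[of _ V]) simp
  qed
  have 24: ?S4 if S2: ?S2
  proof -
    obtain V where V: "\<And>i. i < n \<Longrightarrow> generalized_inverse (U i) (V i)"
      and T: "T = mode_products \<phi> R (\<lambda>i. C i * V i)"
      using S2 by blast
    have Vc: "V i \<in> carrier_mat (l i) (p i)" if "i < n" for i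
      using V[OF that] U[OF that] C[OF that] P[of i] by (auto simp: generalized_inverse_def)
    have "r ! i \<le> mat_rank (C i) \<and> r ! i \<le> mat_rank (N i)" if i: "i < n" for i
    proof -
      obtain m K where K: "K \<in> carrier_mat (prod_list (remove_nth i (dims R))) m"
        and MK: "M i = C i * V i * N i * K"
        using unfolding_mode_products[OF \<phi>, of i R "\<lambda>i. C i * V i"] i Vc dimR
        unfolding orderR M_def N_def T[symmetric] by auto
      have Ni: "N i \<in> carrier_mat (p i) (prod_list (remove_nth i (dims R)))"
        using unfolding_mat_carrier[of \<phi> i R] dimR[OF i] by (simp add: N_def)
      note CV = mult_carrier_mat[OF C[OF i] Vc[OF i]]
      have "r ! i = mat_rank (C i * V i * N i * K)" using MK rankM[OF i] by simp
      also have "\<dots> \<le> mat_rank (C i * V i * N i)"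
        by (rule mat_rank_mult_le_left[OF mult_carrier_mat[OF CV Ni] K])
      finally have "r ! i \<le> mat_rank (C i * V i * N i)" .
      then show ?thesis
        using mat_rank_mult_le_right[OF CV Ni] mat_rank_mult_le_left[OF CV Ni]
          mat_rank_mult_le_left[OF C[OF i] Vc[OF i]] by linarith
    qed
    then show ?thesis
      using rankC_le rankN_le rankM assms(4) n orderR
      by (auto simp: has_multilinear_rank_def N_def intro!: le_antisym)
  qed
  have 41: ?S1 if S4: ?S4
  proof (intro allI impI)
    fix i assume i: "i < n"
    obtain X where X: "X \<in> carrier_mat (l i) (q i)" "M i = C i * X"
      using exX[OF i] S4 i by blast
    obtain m S where S: "S \<in> carrier_mat (q i) m" "N i = P i * M i * S" using exN[OF i] by blast
    have Ui: "U i \<in> carrier_mat (p i) (l i)" unfolding U[OF i] by (rule mult_carrier_mat[OF P C[OF i]])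
    have "P i * M i = U i * X"
      using X(2) U[OF i] assoc_mult_mat[OF P C[OF i] X(1)] by simp
    then have "N i = U i * (X * S)"
      using S(2) assoc_mult_mat[OF Ui X(1) S(1)] by simp
    then have "mat_rank (N i) \<le> mat_rank (U i)"
      using mat_rank_mult_le_left[OF Ui mult_carrier_mat[OF X(1) S(1)]] by simp
    moreover have "mat_rank (N i) = r ! i"
      using S4 i orderR by (simp add: has_multilinear_rank_def N_def)
    ultimately show "mat_rank (U i) = r ! i"
      using rankU_le[OF i] rankC_le[OF i] by linarith
  qed
  have 4: "T = mode_products \<phi> T (\<lambda>i. C i * W i)"
    if S4: ?S4 and W: "\<forall>i<n. generalized_inverse (C i) (W i)" for W
  proof (rule mode_products_fixed[OF \<phi>, symmetric])
    fix i assume "i < order_tensor T"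
    then have i: "i < n" using n by simp
    show "dim_row (C i * W i) = dims T ! i" using C[OF i] assms(3) by simp
    obtain X where X: "X \<in> carrier_mat (l i) (q i)" "M i = C i * X"
      using exX[OF i] S4 i by blast
    have "C i * W i \<in> carrier_mat (d ! i) (d ! i)" "C i * W i * C i = C i"
      using W i C[OF i] by (auto simp: generalized_inverse_def)
    then show "C i * W i * unfolding_mat \<phi> i T = unfolding_mat \<phi> i T"
      using assoc_mult_mat[OF _ C[OF i] X(1), of "C i * W i"] X(2) by (simp add: M_def)
  qed
  show ?thesis
    unfolding Let_def using 13 32 24 41 4 by blast
qed

end
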